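(* Let $j=\min\{i\in[t] : m_i=m_t\}$ and let $d=\sum_{i=1}^{j-1}n_i+1$. Suppose that $n_i\leq m_t$ for all $i\in[t]$. If $q>t$, then there exist MSRD codes $\mathcal{C}_n\subseteq\cdots\subseteq\mathcal{C}_{d+1}\subseteq\mathcal{C}_d\subseteq\mathbb{M}$ with $d(\mathcal{C}_i)=i$ for $d\leq i\leq n=n_1+\cdots+n_t$.
   Context: Write $[r]=\{1,\ldots,r\}$. Let $q$ be a prime power and let $t,n_1,\ldots,n_t,m_1,\ldots,m_t$ be positive integers with $m_1\geq\cdots\geq m_t$ and $m_i\geq n_i$ for $i\in[t]$. Let $\mathbb{M}=\mathbb{F}_q^{m_1\times n_1}\times\cdots\times\mathbb{F}_q^{m_t\times n_t}$ and $n=n_1+\cdots+n_t$. For $C=(C_1,\ldots,C_t)\in\mathbb{M}$ let $\mathrm{srk}(C)=\sum_{i=1}^t\mathrm{rk}(C_i)$. A code is an $\mathbb{F}_q$-linear subspace $\mathcal{C}\subseteq\mathbb{M}$; the minimum distance of $\mathcal{C}\neq 0$ is $d(\mathcal{C})=\min\{\mathrm{srk}(C) : C\in\mathcal{C}\setminus 0\}$. A code $\mathcal{C}\subseteq\mathbb{M}$ is maximum sum-rank distance (MSRD) if there exist $l\in[t]$ and $0\leq\delta\leq n_l-1$ such that $d(\mathcal{C})=\sum_{i=1}^{l-1}n_i+\delta+1$ and $\dim_{\mathbb{F}_q}(\mathcal{C})=\sum_{i=l}^t m_in_i-\delta m_l$. *)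

theory Defs
  imports "Jordan_Normal_Form.DL_Rank" "HOL-Library.FuncSet" "HOL-Library.Cardinality"
begin

(* The field F_q is a type of sort {field, finite} with q = CARD('a).  An element of
   F_q^(m_1 x n_1) x ... x F_q^(m_t x n_t) is an extensional function on {1..t} whose i-th value
   is an m_i x n_i matrix; m and n are only ever looked at on {1..t}. *)
definition mat_tuples ::
  "'a::semiring_1 itself \<Rightarrow> nat \<Rightarrow> (nat \<Rightarrow> nat) \<Rightarrow> (nat \<Rightarrow> nat) \<Rightarrow> ('a, nat \<Rightarrow> 'a mat) module" where
  "mat_tuples ty t m n =
    \<lparr> carrier = (\<Pi>\<^sub>E i\<in>{1..t}. carrier_mat (m i) (n i)),
      mult = undefined,
      one = undefined,
      zero = (\<lambda>i\<in>{1..t}. 0\<^sub>m (m i) (n i)),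
      add = (\<lambda>C D. \<lambda>i\<in>{1..t}. C i + D i),
      smult = (\<lambda>a C. \<lambda>i\<in>{1..t}. a \<cdot>\<^sub>m C i) \<rparr>"

definition srk :: "nat \<Rightarrow> (nat \<Rightarrow> nat) \<Rightarrow> (nat \<Rightarrow> 'a::field mat) \<Rightarrow> nat" where
  "srk t m C = (\<Sum>i\<in>{1..t}. vec_space.rank (m i) (C i))"

definition is_code ::
  "nat \<Rightarrow> (nat \<Rightarrow> nat) \<Rightarrow> (nat \<Rightarrow> nat) \<Rightarrow> (nat \<Rightarrow> 'a::field mat) set \<Rightarrow> bool" where
  "is_code t m n \<C> \<longleftrightarrow> subspace class_ring \<C> (mat_tuples TYPE('a) t m n)"

definition code_dim ::
  "nat \<Rightarrow> (nat \<Rightarrow> nat) \<Rightarrow> (nat \<Rightarrow> nat) \<Rightarrow> (nat \<Rightarrow> 'a::field mat) set \<Rightarrow> nat" where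
  "code_dim t m n \<C> =
    vectorspace.dim class_ring ((mat_tuples TYPE('a) t m n)\<lparr>carrier := \<C>\<rparr>)"

(* Only meaningful for a nonzero code. *)
definition min_dist ::
  "nat \<Rightarrow> (nat \<Rightarrow> nat) \<Rightarrow> (nat \<Rightarrow> nat) \<Rightarrow> (nat \<Rightarrow> 'a::field mat) set \<Rightarrow> nat" where
  "min_dist t m n \<C> = Min (srk t m ` (\<C> - {\<zero>\<^bsub>mat_tuples TYPE('a) t m n\<^esub>}))"

(* For positive n_l the subtractions do not truncate: delta <= n_l - 1 means delta < n_l, and
   delta * m_l is then smaller than the summand m_l * n_l. *)
definition MSRD ::
  "nat \<Rightarrow> (nat \<Rightarrow> nat) \<Rightarrow> (nat \<Rightarrow> nat) \<Rightarrow> (nat \<Rightarrow> 'a::field mat) set \<Rightarrow> bool" where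
  "MSRD t m n \<C> \<longleftrightarrow>
    is_code t m n \<C> \<and> \<C> \<noteq> {\<zero>\<^bsub>mat_tuples TYPE('a) t m n\<^esub>} \<and>
    (\<exists>l\<in>{1..t}. \<exists>\<delta>\<le>n l - 1.
      min_dist t m n \<C> = (\<Sum>i\<in>{1..<l}. n i) + \<delta> + 1 \<and>
      code_dim t m n \<C> = (\<Sum>i\<in>{l..t}. m i * n i) - \<delta> * m l)"

lemma mat_tuples_simps:
  "carrier (mat_tuples ty t m n) = (\<Pi>\<^sub>E i\<in>{1..t}. carrier_mat (m i) (n i))"
  "\<zero>\<^bsub>mat_tuples ty t m n\<^esub> = (\<lambda>i\<in>{1..t}. 0\<^sub>m (m i) (n i))"
  "C \<oplus>\<^bsub>mat_tuples ty t m n\<^esub> D = (\<lambda>i\<in>{1..t}. C i + D i)"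
  "a \<odot>\<^bsub>mat_tuples ty t m n\<^esub> C = (\<lambda>i\<in>{1..t}. a \<cdot>\<^sub>m C i)"
  by (simp_all add: mat_tuples_def)

lemma vectorspace_mat_tuples:
  "vectorspace (class_ring :: 'a::field ring) (mat_tuples TYPE('a) t m n)"
proof -
  let ?V = "mat_tuples TYPE('a) t m n"
  have mem: "C i \<in> carrier_mat (m i) (n i)"
    if "C \<in> carrier ?V" "i \<in> {1..t}" for C :: "nat \<Rightarrow> 'a mat" and i
    using that by (auto simp: mat_tuples_simps)
  have eq: "C = D"
    if "C \<in> carrier ?V" "D \<in> carrier ?V" "\<And>i. i \<in> {1..t} \<Longrightarrow> C i = D i"
    for C D :: "nat \<Rightarrow> 'a mat"
    using that unfolding mat_tuples_simps by (rule PiE_ext)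
  have add: "C \<oplus>\<^bsub>?V\<^esub> D \<in> carrier ?V" if "C \<in> carrier ?V" "D \<in> carrier ?V" for C D
    using mem[OF that(1)] mem[OF that(2)] by (simp add: mat_tuples_simps)
  have smult: "a \<odot>\<^bsub>?V\<^esub> C \<in> carrier ?V" if "C \<in> carrier ?V" for a C
    using mem[OF that] by (simp add: mat_tuples_simps)
  have zero: "\<zero>\<^bsub>?V\<^esub> \<in> carrier ?V"
    by (simp add: mat_tuples_simps)
  note at = mat_tuples_simps(2-4)
  have grp: "abelian_group ?V"
  proof (rule abelian_groupI)
    fix C assume C: "C \<in> carrier ?V"
    have "(- 1) \<odot>\<^bsub>?V\<^esub> C \<oplus>\<^bsub>?V\<^esub> C = \<zero>\<^bsub>?V\<^esub>"
    proof (rule eq[OF add[OF smult[OF C] C] zero])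
      fix i assume i: "i \<in> {1..t}"
      show "((- 1) \<odot>\<^bsub>?V\<^esub> C \<oplus>\<^bsub>?V\<^esub> C) i = \<zero>\<^bsub>?V\<^esub> i"
        using i mem[OF C i] by (intro eq_matI) (auto simp: at)
    qed
    then show "\<exists>D\<in>carrier ?V. D \<oplus>\<^bsub>?V\<^esub> C = \<zero>\<^bsub>?V\<^esub>"
      using smult[OF C] by blast
  next
    fix C D E assume C: "C \<in> carrier ?V" and D: "D \<in> carrier ?V" and E: "E \<in> carrier ?V"
    show "C \<oplus>\<^bsub>?V\<^esub> D \<oplus>\<^bsub>?V\<^esub> E = C \<oplus>\<^bsub>?V\<^esub> (D \<oplus>\<^bsub>?V\<^esub> E)"
    proof (rule eq[OF add[OF add[OF C D] E] add[OF C add[OF D E]]])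
      fix i assume i: "i \<in> {1..t}"
      show "(C \<oplus>\<^bsub>?V\<^esub> D \<oplus>\<^bsub>?V\<^esub> E) i = (C \<oplus>\<^bsub>?V\<^esub> (D \<oplus>\<^bsub>?V\<^esub> E)) i"
        using i assoc_add_mat[OF mem[OF C i] mem[OF D i] mem[OF E i]] by (simp add: at)
    qed
  next
    fix C D assume C: "C \<in> carrier ?V" and D: "D \<in> carrier ?V"
    show "C \<oplus>\<^bsub>?V\<^esub> D = D \<oplus>\<^bsub>?V\<^esub> C"
    proof (rule eq[OF add[OF C D] add[OF D C]])
      fix i assume i: "i \<in> {1..t}"
      show "(C \<oplus>\<^bsub>?V\<^esub> D) i = (D \<oplus>\<^bsub>?V\<^esub> C) i"
        using i comm_add_mat[OF mem[OF C i] mem[OF D i]] by (simp add: at)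
    qed
  next
    fix C assume C: "C \<in> carrier ?V"
    show "\<zero>\<^bsub>?V\<^esub> \<oplus>\<^bsub>?V\<^esub> C = C"
    proof (rule eq[OF add[OF zero C] C])
      fix i assume i: "i \<in> {1..t}"
      show "(\<zero>\<^bsub>?V\<^esub> \<oplus>\<^bsub>?V\<^esub> C) i = C i"
        using i left_add_zero_mat[OF mem[OF C i]] by (simp add: at)
    qed
  qed (use add zero in auto)
  have "module class_ring ?V"
  proof (rule moduleI[OF class_cring.cring_axioms grp])
    fix a b :: 'a and C assume C: "C \<in> carrier ?V"
    show "(a \<oplus>\<^bsub>class_ring\<^esub> b) \<odot>\<^bsub>?V\<^esub> C = a \<odot>\<^bsub>?V\<^esub> C \<oplus>\<^bsub>?V\<^esub> b \<odot>\<^bsub>?V\<^esub> C"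
    proof (rule eq[OF smult[OF C] add[OF smult[OF C] smult[OF C]]])
      fix i assume i: "i \<in> {1..t}"
      show "((a \<oplus>\<^bsub>class_ring\<^esub> b) \<odot>\<^bsub>?V\<^esub> C) i = (a \<odot>\<^bsub>?V\<^esub> C \<oplus>\<^bsub>?V\<^esub> b \<odot>\<^bsub>?V\<^esub> C) i"
        using i add_smult_distrib_right_mat[OF mem[OF C i]] by (simp add: at)
    qed
    show "(a \<otimes>\<^bsub>class_ring\<^esub> b) \<odot>\<^bsub>?V\<^esub> C = a \<odot>\<^bsub>?V\<^esub> (b \<odot>\<^bsub>?V\<^esub> C)"
    proof (rule eq[OF smult[OF C] smult[OF smult[OF C]]])
      fix i assume i: "i \<in> {1..t}"
      show "((a \<otimes>\<^bsub>class_ring\<^esub> b) \<odot>\<^bsub>?V\<^esub> C) i = (a \<odot>\<^bsub>?V\<^esub> (b \<odot>\<^bsub>?V\<^esub> C)) i"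
        using i by (auto simp: at mult.assoc intro!: eq_matI)
    qed
  next
    fix a :: 'a and C D assume C: "C \<in> carrier ?V" and D: "D \<in> carrier ?V"
    show "a \<odot>\<^bsub>?V\<^esub> (C \<oplus>\<^bsub>?V\<^esub> D) = a \<odot>\<^bsub>?V\<^esub> C \<oplus>\<^bsub>?V\<^esub> a \<odot>\<^bsub>?V\<^esub> D"
    proof (rule eq[OF smult[OF add[OF C D]] add[OF smult[OF C] smult[OF D]]])
      fix i assume i: "i \<in> {1..t}"
      show "(a \<odot>\<^bsub>?V\<^esub> (C \<oplus>\<^bsub>?V\<^esub> D)) i = (a \<odot>\<^bsub>?V\<^esub> C \<oplus>\<^bsub>?V\<^esub> a \<odot>\<^bsub>?V\<^esub> D) i"
        using i add_smult_distrib_left_mat[OF mem[OF C i] mem[OF D i]] by (simp add: at)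
    qed
  next
    fix C assume C: "C \<in> carrier ?V"
    show "\<one>\<^bsub>class_ring\<^esub> \<odot>\<^bsub>?V\<^esub> C = C"
    proof (rule eq[OF smult[OF C] C])
      fix i assume i: "i \<in> {1..t}"
      show "(\<one>\<^bsub>class_ring\<^esub> \<odot>\<^bsub>?V\<^esub> C) i = C i"
        using i by (auto simp: at intro!: eq_matI)
    qed
  qed (use smult in auto)
  then show ?thesis
    using class_field.field_axioms by (simp add: vectorspace_def)
qed

end

theory Submission
  imports Defs "HOL-Algebra.Algebraic_Closure_Type"
begin

text \<open>
  The codes are linearized Reed-Solomon codes. Let \<open>M = m\<^sub>t\<close>, and let \<open>a\<^sub>1, \<dots>, a\<^sub>t\<close> be distinct nonzero
  elements of \<open>F\<^sub>q\<close>, which exist since \<open>q > t\<close>. Inside the algebraic closure, the eigenspaces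
  \<open>E\<^sub>i = {x. x^(q^M) = a\<^sub>i x}\<close> of the \<open>M\<close>-th power of the Frobenius map have \<open>q^M\<close> elements each, are linearly
  independent over \<open>F\<^sub>q\<close>, and are preserved by every linearized polynomial
  \<open>F(x) = \<Sum>s<k. f\<^sub>s x^(q^s)\<close> with coefficients in the field \<open>{x. x^(q^M) = x}\<close>. The codeword of \<open>F\<close>
  consists of the matrices of \<open>F\<close> restricted to \<open>n\<^sub>i\<close>-dimensional subspaces of the \<open>E\<^sub>i\<close>. Its kernels
  together embed into the root set of \<open>F\<close>, which has at most \<open>q^(k-1)\<close> elements; hence its weight is at
  least \<open>n - k + 1\<close>. All dimensions are obtained by counting elements.
\<close>

hide_const (open) Polynomials.degree Polynomials.lead_coeff up_ring.monom up_ring.coeff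

subsection \<open>The Frobenius map on the algebraic closure\<close>

lemma card_finite_field_gt_1: "1 < CARD('a::{field,finite})"
proof -
  have "card {0, 1 :: 'a} \<le> CARD('a)"
    by (rule card_mono) auto
  then show ?thesis
    by simp
qed

text \<open>Translation by 1 permutes the field, so adding 1 to each of the \<open>CARD('a)\<close>
  summands leaves the sum of all elements unchanged.\<close>

lemma of_nat_card_eq_0: "of_nat CARD('a) = (0 :: 'a::{field,finite})"
proof -
  have "(\<Sum>a\<in>UNIV. a) = (\<Sum>a\<in>UNIV. a + 1 :: 'a)"
    by (rule sum.reindex_bij_witness[of _ "\<lambda>a. a + 1" "\<lambda>a. a - 1"]) auto
  then show ?thesis
    by (simp add: sum.distrib)
qed

text \<open>Multiplication by a nonzero \<open>x\<close> permutes the nonzero elements; comparing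
  their products gives \<open>x ^ (CARD('a) - 1) = 1\<close>.\<close>

lemma power_card_eq_same: "(x :: 'a::{field,finite}) ^ CARD('a) = x"
proof (cases "x = 0")
  case False
  have "(\<Prod>y\<in>UNIV - {0}. y) = (\<Prod>y\<in>UNIV - {0}. x * y)"
    by (rule prod.reindex_bij_witness[of _ "\<lambda>y. x * y" "\<lambda>y. y / x"]) (use False in auto)
  then have "x ^ (CARD('a) - 1) = 1"
    by (simp add: prod.distrib card_Diff_singleton)
  then show ?thesis
    using power_minus_mult[of "CARD('a)" x] by simp
qed simp

lemma power_card_power_eq_same: "(x :: 'a::{field,finite}) ^ (CARD('a) ^ s) = x"
  by (induction s) (simp_all add: power_mult power_card_eq_same)

lemma to_ac_eq_0_iff: "to_ac x = 0 \<longleftrightarrow> x = 0"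
proof
  assume x: "to_ac x = 0"
  show "x = 0"
  proof (rule ccontr)
    assume "x \<noteq> 0"
    then have "to_ac x * to_ac (inverse x) = 1"
      by (metis right_inverse to_ac_1 to_ac_mult)
    with x show False
      by simp
  qed
qed simp

lemma inj_to_ac: "inj to_ac"
  by (rule injI) (metis eq_iff_diff_eq_0 to_ac_diff to_ac_eq_0_iff)

text \<open>Both sides are monic of the same degree \<open>CARD('a)\<close> and agree on the ground field.\<close>

lemma shift_power_card:
  fixes x :: "'a::{field,finite} alg_closure"
  shows "(x + 1) ^ CARD('a) = x ^ CARD('a) + 1"
proof -
  let ?q = "CARD('a)"
  have "[:1, 1:] ^ ?q = (monom 1 ?q + 1 :: 'a alg_closure poly)"
  proof (rule poly_eqI_degree_lead_coeff[where A = "range to_ac" and n = ?q])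
    show "?q \<le> card (range (to_ac :: 'a \<Rightarrow> _))"
      by (simp add: card_image inj_to_ac)
    show "coeff ([:1, 1:] ^ ?q) ?q = coeff (monom 1 ?q + 1 :: 'a alg_closure poly) ?q"
      by (simp add: coeff_linear_power)
    show "degree ([:1, 1:] ^ ?q :: 'a alg_closure poly) \<le> ?q"
      by (simp add: degree_linear_power)
    show "degree (monom 1 ?q + 1 :: 'a alg_closure poly) \<le> ?q"
      by (rule degree_add_le) (simp_all add: degree_monom_le)
    fix z :: "'a alg_closure"
    assume "z \<in> range to_ac"
    then obtain a where "z = to_ac a"
      by blast
    moreover have "(1 + to_ac a) ^ ?q = to_ac ((1 + a) ^ ?q)" and "to_ac a ^ ?q = to_ac (a ^ ?q)"
      by simp_all
    ultimately show "poly ([:1, 1:] ^ ?q) z = poly (monom 1 ?q + 1) z"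
      by (simp add: poly_monom power_card_eq_same del: to_ac_power)
  qed
  from arg_cong[OF this, of "\<lambda>p. poly p x"] show ?thesis
    by (simp add: poly_monom add.commute)
qed

text \<open>Homogenised from the case \<open>y = 1\<close>: for nonzero \<open>y\<close>, the factor
  \<open>y\<close> is pulled out of both sides.\<close>

lemma add_power_card:
  fixes x y :: "'a::{field,finite} alg_closure"
  shows "(x + y) ^ CARD('a) = x ^ CARD('a) + y ^ CARD('a)"
proof (cases "y = 0")
  case False
  then have "(x + y) ^ CARD('a) = (y * (x / y + 1)) ^ CARD('a)"
    by (simp add: field_simps)
  also have "\<dots> = y ^ CARD('a) * ((x / y) ^ CARD('a) + 1)"
    by (simp only: power_mult_distrib shift_power_card)
  also have "\<dots> = x ^ CARD('a) + y ^ CARD('a)"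
    using False by (simp add: field_simps)
  finally show ?thesis .
qed simp

lemma add_power_card_power:
  fixes x y :: "'a::{field,finite} alg_closure"
  shows "(x + y) ^ (CARD('a) ^ s) = x ^ (CARD('a) ^ s) + y ^ (CARD('a) ^ s)"
  by (induction s arbitrary: x y) (simp_all add: power_mult add_power_card)

lemma sum_power_card_power:
  fixes f :: "'b \<Rightarrow> 'a::{field,finite} alg_closure"
  shows "(\<Sum>i\<in>I. f i) ^ (CARD('a) ^ s) = (\<Sum>i\<in>I. f i ^ (CARD('a) ^ s))"
  by (induction I rule: infinite_finite_induct) (simp_all add: add_power_card_power)

lemma to_ac_power_card_power: "to_ac (a :: 'a::{field,finite}) ^ (CARD('a) ^ s) = to_ac a"
  by (simp add: power_card_power_eq_same flip: to_ac_power)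

text \<open>The polynomial splits into linear factors, and a repeated factor would make its root a
  zero of the derivative too. So the multiset of the \<open>degree p\<close> roots is a set.\<close>

lemma card_roots_separable:
  fixes p :: "'a::alg_closed_field poly"
  assumes "p \<noteq> 0" and "\<And>x. poly p x = 0 \<Longrightarrow> poly (pderiv p) x \<noteq> 0"
  shows "card {x. poly p x = 0} = degree p"
proof -
  obtain A c where A: "size A = degree p" "p = smult c (\<Prod>x\<in>#A. [:-x, 1:])"
    using alg_closed_imp_factorization[OF assms(1)] by metis
  have c: "c \<noteq> 0"
    using assms(1) A(2) by auto
  have roots: "{x. poly p x = 0} = set_mset A"
    using c by (auto simp: A(2) poly_prod_mset)
  have "count A x = 1" if x: "x \<in># A" for x
  proof (rule ccontr)
    assume ne: "count A x \<noteq> 1"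
    obtain B where B: "A = add_mset x B"
      using x by (metis multi_member_split)
    with ne have "x \<in># B"
      by (simp flip: count_greater_zero_iff)
    then obtain B' where "A = add_mset x (add_mset x B')"
      using B by (metis multi_member_split)
    then have p: "p = [:-x, 1:] * ([:-x, 1:] * smult c (\<Prod>x\<in>#B'. [:-x, 1:]))"
      by (simp only: A(2) image_mset_add_mset prod_mset.add_mset mult_smult_right)
    have "poly (pderiv p) x = 0"
      unfolding p by (simp only: pderiv_mult poly_add poly_mult) simp
    moreover have "poly p x = 0"
      using x roots by blast
    ultimately show False
      using assms(2) by blast
  qed
  then have "A = mset_set (set_mset A)"
    by (intro multiset_eqI) (auto simp: count_mset_set' not_in_iff)
  then have "size A = card (set_mset A)"
    by (metis size_mset_set)
  then show ?thesis
    using A(1) roots by simp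
qed

text \<open>Any basis \<open>B\<close> of \<open>E\<close> provides the coordinates; that it has
  \<open>m\<close> elements follows by comparing cardinalities.\<close>

lemma (in vector_space) ex_coordinates:
  assumes fin: "finite (UNIV :: 'a set)" and sub: "subspace E" and card: "card E = CARD('a) ^ m"
  shows "\<exists>b. (\<forall>r<m. b r \<in> E) \<and> bij_betw (\<lambda>v. \<Sum>r<m. v r *s b r) ({..<m} \<rightarrow>\<^sub>E UNIV) E"
proof -
  have card_gt: "1 < CARD('a)"
    using card_mono[OF fin, of "{0, 1}"] by simp
  have "finite E"
    using card card_gt by (intro card_ge_0_finite) simp
  obtain B where B: "B \<subseteq> E" "independent B" "E \<subseteq> span B"
    using maximal_independent_subset by metis
  then have span: "span B = E"
    using span_minimal[OF B(1) sub] by blast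
  have "finite B"
    using B(1) \<open>finite E\<close> finite_subset by blast
  then obtain b where "bij_betw b {0..<card B} B"
    using ex_bij_betw_nat_finite by blast
  then have b: "bij_betw b {..<card B} B"
    by (simp add: atLeast0LessThan)
  \<comment> \<open>\<open>h\<close> inverts the enumeration \<open>b\<close>, so that sums over
    indices become sums over \<open>B\<close>, where independence applies.\<close>
  define h where "h = inv_into {..<card B} b"
  have h: "h (b r) = r" if "r < card B" for r
    using that b unfolding h_def bij_betw_def by simp
  let ?\<phi> = "\<lambda>v. \<Sum>r<card B. v r *s b r"
  have \<phi>_eq: "?\<phi> v = (\<Sum>x\<in>B. v (h x) *s x)" for v
    using sum.reindex_bij_betw[OF b, of "\<lambda>x. v (h x) *s x"] h by simp
  have "bij_betw ?\<phi> ({..<card B} \<rightarrow>\<^sub>E UNIV) E"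
  proof (rule bij_betw_imageI)
    show "inj_on ?\<phi> ({..<card B} \<rightarrow>\<^sub>E UNIV)"
    proof (rule inj_onI)
      fix v w
      assume v: "v \<in> {..<card B} \<rightarrow>\<^sub>E UNIV" and w: "w \<in> {..<card B} \<rightarrow>\<^sub>E UNIV" and "?\<phi> v = ?\<phi> w"
      then have "(\<Sum>x\<in>B. (v (h x) - w (h x)) *s x) = 0"
        unfolding \<phi>_eq by (simp add: scale_left_diff_distrib sum_subtractf)
      then have 0: "v (h x) - w (h x) = 0" if "x \<in> B" for x
        using independentD[OF B(2) \<open>finite B\<close> subset_refl, of "\<lambda>x. v (h x) - w (h x)"] that by simp
      show "v = w"
      proof (rule PiE_ext[OF v w])
        fix r
        assume "r \<in> {..<card B}"
        then have "b r \<in> B" and "h (b r) = r"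
          using b h by (auto dest: bij_betwE)
        then show "v r = w r"
          using 0[of "b r"] by simp
      qed
    qed
    have "E \<subseteq> ?\<phi> ` ({..<card B} \<rightarrow>\<^sub>E UNIV)"
    proof
      fix x
      assume "x \<in> E"
      then obtain u where u: "x = (\<Sum>y\<in>B. u y *s y)"
        using span span_finite[OF \<open>finite B\<close>] by auto
      have "x = ?\<phi> (\<lambda>r\<in>{..<card B}. u (b r))"
        using sum.reindex_bij_betw[OF b, of "\<lambda>y. u y *s y"] by (simp add: u)
      moreover have "(\<lambda>r\<in>{..<card B}. u (b r)) \<in> {..<card B} \<rightarrow>\<^sub>E UNIV"
        by simp
      ultimately show "x \<in> ?\<phi> ` ({..<card B} \<rightarrow>\<^sub>E UNIV)"
        by blast
    qed
    moreover have "?\<phi> v \<in> E" for v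
      unfolding \<phi>_eq using B(1) by (intro subspace_sum[OF sub] subspace_scale[OF sub]) auto
    ultimately show "?\<phi> ` ({..<card B} \<rightarrow>\<^sub>E UNIV) = E"
      by blast
  qed
  moreover from bij_betw_same_card[OF this] have "CARD('a) ^ card B = CARD('a) ^ m"
    by (simp add: card_PiE card)
  then have "card B = m"
    using card_gt by simp
  moreover have "b r \<in> E" if "r < card B" for r
    using that b B(1) by (auto dest: bij_betwE)
  ultimately show ?thesis
    by auto
qed

subsection \<open>Eigenspaces and linearized polynomials\<close>

text \<open>The usual elimination for eigenvectors, here of the additive map raising to the power
  \<open>CARD('a) ^ m\<close>, with distinct eigenvalues \<open>to_ac (l i)\<close>.\<close>

lemma sum_pairwise_distinct_eigenvectors_eq_0:
  fixes x :: "'i \<Rightarrow> 'a::{field,finite} alg_closure"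
  assumes "finite I" and "inj_on l I"
    and "\<And>i. i \<in> I \<Longrightarrow> x i ^ (CARD('a) ^ m) = to_ac (l i) * x i"
    and "(\<Sum>i\<in>I. x i) = 0"
  shows "\<forall>i\<in>I. x i = 0"
  using assms
proof (induction I arbitrary: x rule: finite_induct)
  case (insert j I)
  let ?c = "\<lambda>i. to_ac (l i) - to_ac (l j)"
  have "(\<Sum>i\<in>insert j I. x i) ^ (CARD('a) ^ m) = 0"
    using insert.prems(3) by (simp add: power_0_left)
  then have "(\<Sum>i\<in>insert j I. to_ac (l i) * x i) = 0"
    by (simp only: sum_power_card_power insert.prems(2) cong: sum.cong)
  \<comment> \<open>Subtracting \<open>to_ac (l j)\<close> times the relation from its image cancels
    the term of \<open>j\<close>.\<close>
  then have "(\<Sum>i\<in>insert j I. to_ac (l i) * x i) - to_ac (l j) * (\<Sum>i\<in>insert j I. x i) = 0"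
    using insert.prems(3) by simp
  then have "(\<Sum>i\<in>I. ?c i * x i) = 0"
    using insert.hyps by (simp add: algebra_simps sum_distrib_left sum_subtractf)
  \<comment> \<open>\<open>?c i\<close> comes from the ground field and is fixed by the Frobenius
    map, so the scaled vectors are again eigenvectors.\<close>
  moreover have "(?c i * x i) ^ (CARD('a) ^ m) = to_ac (l i) * (?c i * x i)" if "i \<in> I" for i
  proof -
    have "?c i ^ (CARD('a) ^ m) = ?c i"
      using to_ac_power_card_power[of "l i - l j"] by simp
    then show ?thesis
      using insert.prems(2)[of i] that by (simp add: power_mult_distrib)
  qed
  ultimately have "\<forall>i\<in>I. ?c i * x i = 0"
    using insert.prems(1) by (intro insert.IH) (auto simp: inj_on_insert)
  moreover have "?c i \<noteq> 0" if "i \<in> I" for i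
  proof -
    have "l i \<noteq> l j"
      using that insert.prems(1) insert.hyps(2) by (auto simp: inj_on_def)
    then show ?thesis
      using inj_to_ac by (simp add: inj_eq)
  qed
  ultimately have "\<forall>i\<in>I. x i = 0"
    by auto
  then show ?case
    using insert.prems(3) insert.hyps by simp
qed simp

text \<open>For \<open>a = 1\<close> this is the subfield from which the coefficients of the
  linearized polynomials are drawn; the evaluation points of a block lie in the eigenspace of that
  block's \<open>a\<close>.\<close>

definition frob_eigenspace :: "nat \<Rightarrow> 'a::{field,finite} \<Rightarrow> 'a alg_closure set" where
  "frob_eigenspace m a = {x. x ^ (CARD('a) ^ m) = to_ac a * x}"

lemma frob_eigenspace_add:
  "x \<in> frob_eigenspace m a \<Longrightarrow> y \<in> frob_eigenspace m a \<Longrightarrow> x + y \<in> frob_eigenspace m a"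
  by (simp add: frob_eigenspace_def add_power_card_power algebra_simps)

lemma frob_eigenspace_scale:
  "x \<in> frob_eigenspace m a \<Longrightarrow> to_ac c * x \<in> frob_eigenspace m a"
  by (simp add: frob_eigenspace_def power_mult_distrib to_ac_power_card_power)

lemma zero_in_frob_eigenspace: "0 \<in> frob_eigenspace m a"
  by (simp add: frob_eigenspace_def power_0_left)

lemma vector_space_to_ac: "vector_space (\<lambda>a x. to_ac a * x)"
  by unfold_locales (simp_all add: algebra_simps)

text \<open>The defining polynomial \<open>?p\<close> has the nonzero constant
  \<open>- to_ac a\<close> as derivative, because \<open>?Q\<close> vanishes in the field; so it has
  \<open>?Q\<close> distinct roots.\<close>

lemma card_frob_eigenspace:
  fixes a :: "'a::{field,finite}"
  assumes "m > 0" and "a \<noteq> 0"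
  shows "card (frob_eigenspace m a) = CARD('a) ^ m"
proof -
  let ?Q = "CARD('a) ^ m"
  let ?p = "monom 1 ?Q + [:0, - to_ac a:]"
  have Q: "1 < ?Q"
    using assms(1) card_finite_field_gt_1[where 'a = 'a] by (intro one_less_power)
  have deg: "degree ?p = ?Q"
    using Q by (subst degree_add_eq_left) (auto simp: degree_monom_eq)
  have "of_nat ?Q = (0 :: 'a alg_closure)"
    using assms(1) of_nat_card_eq_0[where 'a = 'a] to_ac_of_nat[of "CARD('a)", where 'a = 'a]
    by (simp add: power_0_left)
  then have "pderiv ?p = [:- to_ac a:]"
    by (simp add: pderiv_add pderiv_monom pderiv_pCons)
  then have "card {x. poly ?p x = 0} = degree ?p"
    using assms(2) deg Q by (intro card_roots_separable) (auto simp: to_ac_eq_0_iff)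
  moreover have "frob_eigenspace m a = {x. poly ?p x = 0}"
    by (auto simp: frob_eigenspace_def poly_monom algebra_simps)
  ultimately show ?thesis
    using deg by simp
qed

lemma ex_frob_eigenspace_basis:
  fixes a :: "'a::{field,finite}"
  assumes "m > 0" and "a \<noteq> 0"
  shows "\<exists>b. (\<forall>r<m. b r \<in> frob_eigenspace m a) \<and>
    bij_betw (\<lambda>v. \<Sum>r<m. to_ac (v r) * b r) ({..<m} \<rightarrow>\<^sub>E UNIV) (frob_eigenspace m a)"
proof -
  interpret ac: vector_space "\<lambda>(a :: 'a) x. to_ac a * x"
    by (rule vector_space_to_ac)
  have "ac.subspace (frob_eigenspace m a)"
    by (auto simp: ac.subspace_def intro: frob_eigenspace_add frob_eigenspace_scale zero_in_frob_eigenspace)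
  then show ?thesis
    using ac.ex_coordinates[OF _ _ card_frob_eigenspace[OF assms]] by simp
qed

definition lin_eval :: "nat \<Rightarrow> (nat \<Rightarrow> 'a::{field,finite} alg_closure) \<Rightarrow> 'a alg_closure \<Rightarrow> 'a alg_closure" where
  "lin_eval k f x = (\<Sum>s<k. f s * x ^ (CARD('a) ^ s))"

lemma lin_eval_add: "lin_eval k f (x + y) = lin_eval k f x + lin_eval k f y"
  by (simp add: lin_eval_def add_power_card_power algebra_simps sum.distrib)

lemma lin_eval_scale: "lin_eval k f (to_ac c * x) = to_ac c * lin_eval k f x"
  by (simp add: lin_eval_def power_mult_distrib to_ac_power_card_power sum_distrib_left algebra_simps)

lemma lin_eval_0: "lin_eval k f 0 = 0"
  by (simp add: lin_eval_def power_0_left)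

lemma lin_eval_sum: "lin_eval k f (\<Sum>i\<in>I. x i) = (\<Sum>i\<in>I. lin_eval k f (x i))"
  by (induction I rule: infinite_finite_induct) (simp_all add: lin_eval_add lin_eval_0)

text \<open>Raising to the power \<open>CARD('a) ^ m\<close> fixes the coefficients and commutes
  with each power \<open>CARD('a) ^ s\<close>, which in turn fixes the eigenvalue
  \<open>to_ac a\<close>.\<close>

lemma lin_eval_in_frob_eigenspace:
  assumes "\<And>s. s < k \<Longrightarrow> f s \<in> frob_eigenspace m 1" and "x \<in> frob_eigenspace m a"
  shows "lin_eval k f x \<in> frob_eigenspace m a"
proof -
  have "(f s * x ^ (CARD('a) ^ s)) ^ (CARD('a) ^ m) = to_ac a * (f s * x ^ (CARD('a) ^ s))" if "s < k" for s
  proof -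
    have "(x ^ (CARD('a) ^ s)) ^ (CARD('a) ^ m) = (x ^ (CARD('a) ^ m)) ^ (CARD('a) ^ s)"
      by (simp flip: power_mult add: mult.commute)
    then show ?thesis
      using assms(1)[OF that] assms(2)
      by (simp add: frob_eigenspace_def power_mult_distrib to_ac_power_card_power)
  qed
  then show ?thesis
    by (simp add: frob_eigenspace_def lin_eval_def sum_power_card_power sum_distrib_left)
qed

text \<open>The exponents \<open>CARD('a) ^ s\<close> are distinct, so the nonzero
  \<open>f s\<close> survives as a coefficient of the ordinary polynomial \<open>?p\<close>, whose
  degree is at most \<open>CARD('a) ^ (k - 1)\<close>.\<close>

lemma lin_eval_roots:
  fixes f :: "nat \<Rightarrow> 'a::{field,finite} alg_closure"
  assumes "s < k" and "f s \<noteq> 0"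
  shows "finite {x. lin_eval k f x = 0}" and "card {x. lin_eval k f x = 0} \<le> CARD('a) ^ (k - 1)"
proof -
  let ?p = "\<Sum>s<k. monom (f s) (CARD('a) ^ s)"
  have inj: "CARD('a) ^ s' = CARD('a) ^ s \<longleftrightarrow> s' = s" for s'
    using card_finite_field_gt_1[where 'a = 'a] by simp
  have "coeff ?p (CARD('a) ^ s) = f s"
    using assms(1) by (simp add: coeff_sum inj)
  then have p: "?p \<noteq> 0"
    using assms(2) by auto
  have "degree ?p \<le> CARD('a) ^ (k - 1)"
  proof (rule degree_sum_le)
    fix s'
    assume "s' \<in> {..<k}"
    then have "CARD('a) ^ s' \<le> CARD('a) ^ (k - 1)"
      by (intro power_increasing) auto
    then show "degree (monom (f s') (CARD('a) ^ s')) \<le> CARD('a) ^ (k - 1)"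
      using degree_monom_le order_trans by blast
  qed simp
  moreover have eq: "{x. lin_eval k f x = 0} = {x. poly ?p x = 0}"
    by (simp add: lin_eval_def poly_sum poly_monom)
  ultimately show "finite {x. lin_eval k f x = 0}" and "card {x. lin_eval k f x = 0} \<le> CARD('a) ^ (k - 1)"
    using poly_roots_finite[OF p] card_poly_roots_bound[OF p] by auto
qed

lemma frob_eigenspace_diff:
  "x \<in> frob_eigenspace m a \<Longrightarrow> y \<in> frob_eigenspace m a \<Longrightarrow> x - y \<in> frob_eigenspace m a"
  using frob_eigenspace_add[of x m a "- y"] frob_eigenspace_scale[of y m a "- 1"] by simp

lemma frob_eigenspace_sum:
  "(\<And>i. i \<in> I \<Longrightarrow> x i \<in> frob_eigenspace m a) \<Longrightarrow> (\<Sum>i\<in>I. x i) \<in> frob_eigenspace m a"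
  by (induction I rule: infinite_finite_induct) (auto intro: frob_eigenspace_add zero_in_frob_eigenspace)

lemma lin_eval_diff_coeffs: "lin_eval k (\<lambda>s. f s - g s) x = lin_eval k f x - lin_eval k g x"
  by (simp add: lin_eval_def algebra_simps sum_subtractf)

subsection \<open>Counting and matrix rank\<close>

text \<open>Coordinates in a finite basis biject onto the space. Through this, ranks and code
  dimensions become cardinalities.\<close>

lemma card_vectorspace:
  fixes V :: "('a::{field,finite}, 'v) module"
  assumes "vectorspace class_ring V" and fin_V: "finite (carrier V)"
  shows "card (carrier V) = CARD('a) ^ vectorspace.dim class_ring V"
proof -
  interpret vectorspace class_ring V
    by (rule assms(1))
  have "span (carrier V) = carrier V"
    using in_own_span[of "carrier V"] span_is_subset2[of "carrier V"] by blast
  then have "fin_dim"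
    using fin_V unfolding fin_dim_def by blast
  then obtain B where B: "finite B" "basis B"
    using finite_basis_exists by blast
  then have BV: "B \<subseteq> carrier V"
    by (simp add: basis_def)
  have crit: "\<exists>!a. a \<in> B \<rightarrow>\<^sub>E UNIV \<and> lincomb a B = v" if "v \<in> carrier V" for v
    using basis_criterion[OF B(1) BV] B(2) that by simp
  have closed: "lincomb a B \<in> carrier V" for a
    using BV by (intro lincomb_closed) auto
  have "bij_betw (\<lambda>a. lincomb a B) (B \<rightarrow>\<^sub>E UNIV) (carrier V)"
  proof (rule bij_betw_imageI)
    show "inj_on (\<lambda>a. lincomb a B) (B \<rightarrow>\<^sub>E UNIV)"
    proof (rule inj_onI)
      fix a b
      assume "a \<in> B \<rightarrow>\<^sub>E UNIV" "b \<in> B \<rightarrow>\<^sub>E UNIV" "lincomb a B = lincomb b B"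
      then show "a = b"
        using crit[OF closed[of b]] by blast
    qed
    have "v \<in> (\<lambda>a. lincomb a B) ` (B \<rightarrow>\<^sub>E UNIV)" if "v \<in> carrier V" for v
      using crit[OF that] by blast
    then show "(\<lambda>a. lincomb a B) ` (B \<rightarrow>\<^sub>E UNIV) = carrier V"
      using closed by blast
  qed
  from bij_betw_same_card[OF this] have "CARD('a) ^ card B = card (carrier V)"
    using B(1) by (simp add: card_PiE)
  then show ?thesis
    using dim_basis[OF B] by simp
qed

lemma bij_betw_vec: "bij_betw (vec n) ({..<n} \<rightarrow>\<^sub>E (UNIV :: 'a set)) (carrier_vec n)"
proof (rule bij_betw_imageI)
  show "inj_on (vec n) ({..<n} \<rightarrow>\<^sub>E (UNIV :: 'a set))"
  proof (intro inj_onI)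
    fix v w :: "nat \<Rightarrow> 'a"
    assume v: "v \<in> {..<n} \<rightarrow>\<^sub>E UNIV" and w: "w \<in> {..<n} \<rightarrow>\<^sub>E UNIV" and eq: "vec n v = vec n w"
    have "v i = w i" if "i < n" for i
      using that arg_cong[OF eq, of "\<lambda>u. vec_index u i"] by simp
    then show "v = w"
      using PiE_ext[OF v w] by simp
  qed
  show "vec n ` ({..<n} \<rightarrow>\<^sub>E (UNIV :: 'a set)) = carrier_vec n"
  proof (rule antisym)
    show "vec n ` ({..<n} \<rightarrow>\<^sub>E (UNIV :: 'a set)) \<subseteq> carrier_vec n"
      by (rule image_subsetI) simp
    show "carrier_vec n \<subseteq> vec n ` ({..<n} \<rightarrow>\<^sub>E (UNIV :: 'a set))"
    proof
      fix v :: "'a vec"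
      assume "v \<in> carrier_vec n"
      then have "v = vec n (\<lambda>i\<in>{..<n}. v $ i)"
        by auto
      moreover have "(\<lambda>i\<in>{..<n}. v $ i) \<in> {..<n} \<rightarrow>\<^sub>E UNIV"
        by simp
      ultimately show "v \<in> vec n ` ({..<n} \<rightarrow>\<^sub>E UNIV)"
        by blast
    qed
  qed
qed

lemma card_carrier_vec: "card (carrier_vec n :: 'a::finite vec set) = CARD('a) ^ n"
  using bij_betw_same_card[OF bij_betw_vec[of n, where 'a = 'a]] by (simp add: card_PiE)

lemma finite_carrier_vec: "finite (carrier_vec n :: 'a::finite vec set)"
  using bij_betw_finite[OF bij_betw_vec[of n, where 'a = 'a]] by (simp add: finite_PiE)

text \<open>The image is the span of the columns, whose dimension is the rank by definition.\<close>

lemma card_mat_image: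
  fixes A :: "'a::{field,finite} mat"
  assumes A: "A \<in> carrier_mat nr nc"
  shows "card ((\<lambda>v. A *\<^sub>v v) ` carrier_vec nc) = CARD('a) ^ vec_space.rank nr A"
proof -
  interpret vec_space "TYPE('a)" nr .
  have cols: "set (cols A) \<subseteq> carrier_vec nr"
    using A cols_dim by blast
  have [simp]: "mat_of_cols nr (cols A) = A" "length (cols A) = nc"
    using A by auto
  have "span (set (cols A)) = {lincomb_list c (cols A) | c. True}"
    using span_list_as_span[OF cols] by (simp add: span_list_def)
  also have "\<dots> = {A *\<^sub>v vec nc c | c. True}"
  proof -
    have "lincomb_list c (cols A) = A *\<^sub>v vec nc c" for c
      using lincomb_list_as_mat_mult[of "cols A" c] subsetD[OF cols] A by simp
    then show ?thesis
      by simp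
  qed
  also have "\<dots> = (\<lambda>v. A *\<^sub>v v) ` carrier_vec nc"
  proof -
    have "\<exists>c. v = vec nc c" if "v \<in> carrier_vec nc" for v :: "'a vec"
      using that by (intro exI[of _ "\<lambda>i. v $ i"]) auto
    then show ?thesis
      by force
  qed
  finally have span: "span (set (cols A)) = (\<lambda>v. A *\<^sub>v v) ` carrier_vec nc" .
  have "vectorspace class_ring (span_vs (set (cols A)))"
    using cols by (intro subspace_is_vs span_is_subspace) simp
  from card_vectorspace[OF this] show ?thesis
    unfolding rank_def by (simp add: span finite_carrier_vec)
qed

text \<open>Rank-nullity in counted form: every nonempty fibre is a translate of the kernel.\<close>

lemma card_mat_kernel:
  fixes A :: "'a::{field,finite} mat"
  assumes A: "A \<in> carrier_mat nr nc"
  shows "CARD('a) ^ vec_space.rank nr A * card {v \<in> carrier_vec nc. A *\<^sub>v v = 0\<^sub>v nr} = CARD('a) ^ nc"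
proof -
  let ?ker = "{v \<in> carrier_vec nc. A *\<^sub>v v = 0\<^sub>v nr}"
  have fiber: "card {v \<in> carrier_vec nc. A *\<^sub>v v = y} = card ?ker" if y: "y \<in> (\<lambda>v. A *\<^sub>v v) ` carrier_vec nc" for y
  proof -
    obtain u where u: "u \<in> carrier_vec nc" "y = A *\<^sub>v u"
      using y by blast
    have "bij_betw (\<lambda>v. v + u) ?ker {v \<in> carrier_vec nc. A *\<^sub>v v = y}"
      by (rule bij_betwI[where g = "\<lambda>v. v - u"])
         (use A u in \<open>auto simp: mult_add_distrib_mat_vec mult_minus_distrib_mat_vec\<close>)
    then show ?thesis
      by (simp add: bij_betw_same_card)
  qed
  have "CARD('a) ^ nc = (\<Sum>v\<in>(carrier_vec nc :: 'a vec set). 1)"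
    by (simp add: card_carrier_vec)
  also have "\<dots> = (\<Sum>y\<in>(\<lambda>v. A *\<^sub>v v) ` carrier_vec nc. card {v \<in> carrier_vec nc. A *\<^sub>v v = y})"
    by (subst sum.image_gen[OF finite_carrier_vec, of _ _ "\<lambda>v. A *\<^sub>v v"]) simp
  also have "\<dots> = card ((\<lambda>v. A *\<^sub>v v) ` carrier_vec nc) * card ?ker"
    by (simp add: fiber)
  finally show ?thesis
    using card_mat_image[OF A] by simp
qed

text \<open>The rank is the size of a maximal independent set of columns, and such a set omits the
  zero vector.\<close>

lemma rank_le_card_nonzero_cols:
  fixes A :: "'a::field mat"
  assumes A: "A \<in> carrier_mat nr nc"
  shows "vec_space.rank nr A \<le> card {c \<in> {..<nc}. col A c \<noteq> 0\<^sub>v nr}"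
proof -
  interpret vec_space "TYPE('a)" nr .
  let ?P = "\<lambda>T. T \<subseteq> set (cols A) \<and> lin_indpt T"
  obtain S where S: "maximal S ?P" "finite S"
    using maximal_exists_superset[of "set (cols A)" ?P "{}"] finite_lin_indpt2[of "{}"] by auto
  then have "S \<subseteq> set (cols A)" "lin_indpt S"
    by (auto simp: maximal_def)
  moreover from this have "0\<^sub>v nr \<notin> S"
  proof -
    assume "S \<subseteq> set (cols A)" "lin_indpt S"
    moreover from this have "S \<subseteq> carrier_vec nr"
      using A cols_dim[of A] by blast
    moreover have "(UNIV :: 'a set) \<noteq> {0}"
      by (metis UNIV_I singletonD zero_neq_one)
    ultimately show ?thesis
      using zero_nin_lin_indpt[of S] by simp
  qed
  ultimately have "S \<subseteq> col A ` {c \<in> {..<nc}. col A c \<noteq> 0\<^sub>v nr}"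
  proof -
    assume S: "S \<subseteq> set (cols A)" "0\<^sub>v nr \<notin> S"
    show ?thesis
    proof
      fix v
      assume "v \<in> S"
      with S A obtain c where "c < nc" "v = col A c"
        by (auto simp: cols_def)
      with \<open>v \<in> S\<close> S(2) show "v \<in> col A ` {c \<in> {..<nc}. col A c \<noteq> 0\<^sub>v nr}"
        by auto
    qed
  qed
  then have "card S \<le> card {c \<in> {..<nc}. col A c \<noteq> 0\<^sub>v nr}"
    by (intro surj_card_le) auto
  then show ?thesis
    using rank_card_indpt[OF A S(1)] by simp
qed

subsection \<open>Linearized Reed-Solomon codes\<close>

text \<open>All \<open>M\<close> vectors \<open>b i r\<close> serve as coordinates for values, but
  only the first \<open>n i\<close> of them as evaluation points. That \<open>a i\<close> is nonzero
  enters through \<open>b_basis\<close>, which forces the eigenspace to have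
  \<open>CARD('a) ^ M\<close> elements.\<close>

locale linearized_reed_solomon =
  fixes t M :: nat and n m :: "nat \<Rightarrow> nat"
    and a :: "nat \<Rightarrow> 'a::{field,finite}" and b :: "nat \<Rightarrow> nat \<Rightarrow> 'a alg_closure"
  assumes M_pos: "0 < M"
    and n_le_M: "\<And>i. i \<in> {1..t} \<Longrightarrow> n i \<le> M"
    and M_le_m: "\<And>i. i \<in> {1..t} \<Longrightarrow> M \<le> m i"
    and inj_a: "inj_on a {1..t}"
    and b_in: "\<And>i r. i \<in> {1..t} \<Longrightarrow> r < M \<Longrightarrow> b i r \<in> frob_eigenspace M (a i)"
    and b_basis: "\<And>i. i \<in> {1..t} \<Longrightarrow> bij_betw (\<lambda>v. \<Sum>r<M. to_ac (v r) * b i r)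
      ({..<M} \<rightarrow>\<^sub>E UNIV) (frob_eigenspace M (a i))"
begin

section \<open>Coordinates in the eigenspaces and the encoding of polynomials\<close>

abbreviation "V \<equiv> mat_tuples TYPE('a) t m n"

text \<open>Only the first \<open>M\<close> values of the argument count, so a matrix column with
  \<open>m i\<close> entries can be passed directly.\<close>

definition comb :: "nat \<Rightarrow> (nat \<Rightarrow> 'a) \<Rightarrow> 'a alg_closure" where
  "comb i v = (\<Sum>r<M. to_ac (v r) * b i r)"

lemma comb_cong: "(\<And>r. r < M \<Longrightarrow> v r = w r) \<Longrightarrow> comb i v = comb i w"
  by (simp add: comb_def)

lemma comb_add: "comb i (\<lambda>r. v r + w r) = comb i v + comb i w"
  by (simp add: comb_def algebra_simps sum.distrib)

lemma comb_scale: "comb i (\<lambda>r. c * v r) = to_ac c * comb i v"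
  by (simp add: comb_def algebra_simps sum_distrib_left)

lemma comb_0: "comb i (\<lambda>r. 0) = 0"
  by (simp add: comb_def)

lemma comb_in: "i \<in> {1..t} \<Longrightarrow> comb i v \<in> frob_eigenspace M (a i)"
  unfolding comb_def by (intro frob_eigenspace_sum frob_eigenspace_scale b_in) auto

lemma comb_eqD:
  assumes "i \<in> {1..t}" and "comb i v = comb i w" and "r < M"
  shows "v r = w r"
proof -
  \<comment> \<open>Injectivity in \<open>b_basis\<close> concerns extensional functions, hence the
    restriction.\<close>
  have "comb i (restrict v {..<M}) = comb i (restrict w {..<M})"
    using assms(2) comb_cong[of "restrict v {..<M}" v i] comb_cong[of "restrict w {..<M}" w i] by simp
  then have "restrict v {..<M} = restrict w {..<M}"
    using b_basis[OF assms(1)] unfolding bij_betw_def comb_def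
    by (elim conjE inj_onD) auto
  from fun_cong[OF this, of r] show ?thesis
    using assms(3) by simp
qed

lemma ex_comb:
  assumes "i \<in> {1..t}" and "x \<in> frob_eigenspace M (a i)"
  shows "\<exists>v. comb i v = x"
  using b_basis[OF assms(1)] assms(2) unfolding bij_betw_def comb_def by (metis (no_types, lifting) imageE)

text \<open>The columns of the \<open>i\<close>-th block are the coordinates of the values of the polynomial with respect to the
  basis \<open>b i\<close> of the \<open>i\<close>-th eigenspace, padded with zeros from \<open>M\<close> to \<open>m i\<close> entries.\<close>

definition encodes :: "nat \<Rightarrow> (nat \<Rightarrow> 'a alg_closure) \<Rightarrow> (nat \<Rightarrow> 'a mat) \<Rightarrow> bool" where
  "encodes k f C \<longleftrightarrow> C \<in> carrier V \<and> (\<forall>i\<in>{1..t}. \<forall>c<n i.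
    comb i (\<lambda>r. C i $$ (r, c)) = lin_eval k f (b i c) \<and> (\<forall>r\<in>{M..<m i}. C i $$ (r, c) = 0))"

text \<open>Coefficients from \<open>k\<close> on do not affect the evaluation and are left free;
  this keeps the coefficient functions closed under sums and multiples.\<close>

definition code :: "nat \<Rightarrow> (nat \<Rightarrow> 'a mat) set" where
  "code k = {C. \<exists>f\<in>{..<k} \<rightarrow> frob_eigenspace M 1. encodes k f C}"

lemma encodes_carrier: "encodes k f C \<Longrightarrow> i \<in> {1..t} \<Longrightarrow> C i \<in> carrier_mat (m i) (n i)"
  by (auto simp: encodes_def mat_tuples_simps)

lemma encodes_comb:
  "encodes k f C \<Longrightarrow> i \<in> {1..t} \<Longrightarrow> c < n i \<Longrightarrow> comb i (\<lambda>r. C i $$ (r, c)) = lin_eval k f (b i c)"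
  by (auto simp: encodes_def)

lemma encodes_padding:
  "encodes k f C \<Longrightarrow> i \<in> {1..t} \<Longrightarrow> c < n i \<Longrightarrow> M \<le> r \<Longrightarrow> r < m i \<Longrightarrow> C i $$ (r, c) = 0"
  by (auto simp: encodes_def)

lemma encodesI:
  assumes "C \<in> carrier V"
    and "\<And>i c. i \<in> {1..t} \<Longrightarrow> c < n i \<Longrightarrow> comb i (\<lambda>r. C i $$ (r, c)) = lin_eval k f (b i c)"
    and "\<And>i c r. i \<in> {1..t} \<Longrightarrow> c < n i \<Longrightarrow> M \<le> r \<Longrightarrow> r < m i \<Longrightarrow> C i $$ (r, c) = 0"
  shows "encodes k f C"
  using assms by (simp add: encodes_def)

text \<open>The values of the polynomial stay in the eigenspace of the block, so they have
  coordinates in \<open>b i\<close>.\<close>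

lemma ex_encodes:
  assumes f: "f \<in> {..<k} \<rightarrow> frob_eigenspace M 1"
  shows "\<exists>C. encodes k f C"
proof -
  have "\<exists>v. comb i v = lin_eval k f (b i c)" if "i \<in> {1..t}" "c < n i" for i c
    using that n_le_M[OF that(1)] f
    by (intro ex_comb lin_eval_in_frob_eigenspace b_in) auto
  then obtain w where w: "\<And>i c. i \<in> {1..t} \<Longrightarrow> c < n i \<Longrightarrow> comb i (w i c) = lin_eval k f (b i c)"
    by metis
  let ?C = "\<lambda>i\<in>{1..t}. mat (m i) (n i) (\<lambda>(r, c). if r < M then w i c r else 0)"
  have "encodes k f ?C"
  proof (rule encodesI)
    show "?C \<in> carrier V"
      by (simp add: mat_tuples_simps)
    fix i c
    assume ic: "i \<in> {1..t}" "c < n i"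
    then have "comb i (\<lambda>r. ?C i $$ (r, c)) = comb i (w i c)"
      using M_le_m[OF ic(1)] by (intro comb_cong) simp
    then show "comb i (\<lambda>r. ?C i $$ (r, c)) = lin_eval k f (b i c)"
      using w[OF ic] by simp
  qed simp
  then show ?thesis
    by blast
qed

lemma encodes_unique:
  assumes C: "encodes k f C" and D: "encodes k f D"
  shows "C = D"
proof (rule PiE_ext)
  show "C \<in> (\<Pi>\<^sub>E i\<in>{1..t}. carrier_mat (m i) (n i))" "D \<in> (\<Pi>\<^sub>E i\<in>{1..t}. carrier_mat (m i) (n i))"
    using C D by (simp_all add: encodes_def mat_tuples_simps)
  fix i
  assume i: "i \<in> {1..t}"
  show "C i = D i"
  proof (rule eq_matI)
    fix r c
    assume "r < dim_row (D i)" "c < dim_col (D i)"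
    then have rc: "r < m i" "c < n i"
      using encodes_carrier[OF D i] by auto
    \<comment> \<open>Rows below \<open>M\<close> are determined by the values of the polynomial;
      the others are zero padding.\<close>
    show "C i $$ (r, c) = D i $$ (r, c)"
    proof (cases "r < M")
      case True
      then show ?thesis
        using comb_eqD[OF i _ True, of "\<lambda>r. C i $$ (r, c)" "\<lambda>r. D i $$ (r, c)"]
          encodes_comb[OF C i rc(2)] encodes_comb[OF D i rc(2)] by simp
    next
      case False
      then show ?thesis
        using encodes_padding[OF C i rc(2) _ rc(1)] encodes_padding[OF D i rc(2) _ rc(1)] by simp
    qed
  qed (use encodes_carrier[OF C i] encodes_carrier[OF D i] in auto)
qed

lemma encodes_zero:
  assumes "\<And>s. s < k \<Longrightarrow> f s = 0"
  shows "encodes k f \<zero>\<^bsub>V\<^esub>"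
proof (rule encodesI)
  fix i c
  assume ic: "i \<in> {1..t}" "c < n i"
  have "comb i (\<lambda>r. \<zero>\<^bsub>V\<^esub> i $$ (r, c)) = comb i (\<lambda>r. 0)"
    using ic M_le_m[OF ic(1)] by (intro comb_cong) (simp add: mat_tuples_simps)
  then show "comb i (\<lambda>r. \<zero>\<^bsub>V\<^esub> i $$ (r, c)) = lin_eval k f (b i c)"
    using assms by (simp add: comb_0 lin_eval_def)
qed (simp_all add: mat_tuples_simps)

text \<open>Reduces injectivity of the encoding to polynomials that encode the zero tuple, which
  \<open>srk_lower_bound\<close> can exclude.\<close>

lemma encodes_same_diff:
  assumes f: "encodes k f C" and g: "encodes k g C"
  shows "encodes k (\<lambda>s. f s - g s) \<zero>\<^bsub>V\<^esub>"
proof (rule encodesI)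
  fix i c
  assume ic: "i \<in> {1..t}" "c < n i"
  have "comb i (\<lambda>r. \<zero>\<^bsub>V\<^esub> i $$ (r, c)) = comb i (\<lambda>r. 0)"
    using ic M_le_m[OF ic(1)] by (intro comb_cong) (simp add: mat_tuples_simps)
  then show "comb i (\<lambda>r. \<zero>\<^bsub>V\<^esub> i $$ (r, c)) = lin_eval k (\<lambda>s. f s - g s) (b i c)"
    using encodes_comb[OF f ic] encodes_comb[OF g ic] by (simp add: comb_0 lin_eval_diff_coeffs)
qed (simp_all add: mat_tuples_simps)

lemma encodes_add:
  assumes C: "encodes k f C" and D: "encodes k g D"
  shows "encodes k (\<lambda>s. f s + g s) (C \<oplus>\<^bsub>V\<^esub> D)"
proof (rule encodesI)
  show "C \<oplus>\<^bsub>V\<^esub> D \<in> carrier V"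
    using encodes_carrier[OF C] encodes_carrier[OF D] by (simp add: mat_tuples_simps)
  fix i c
  assume ic: "i \<in> {1..t}" "c < n i"
  have at: "(C \<oplus>\<^bsub>V\<^esub> D) i $$ (r, c) = C i $$ (r, c) + D i $$ (r, c)" if "r < m i" for r
    using ic that encodes_carrier[OF C ic(1)] encodes_carrier[OF D ic(1)] by (simp add: mat_tuples_simps)
  have "comb i (\<lambda>r. (C \<oplus>\<^bsub>V\<^esub> D) i $$ (r, c)) = comb i (\<lambda>r. C i $$ (r, c) + D i $$ (r, c))"
    using M_le_m[OF ic(1)] by (intro comb_cong at) simp
  then show "comb i (\<lambda>r. (C \<oplus>\<^bsub>V\<^esub> D) i $$ (r, c)) = lin_eval k (\<lambda>s. f s + g s) (b i c)"
    using encodes_comb[OF C ic] encodes_comb[OF D ic]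
    by (simp add: comb_add lin_eval_def algebra_simps sum.distrib)
  show "(C \<oplus>\<^bsub>V\<^esub> D) i $$ (r, c) = 0" if "M \<le> r" "r < m i" for r
    using at[OF that(2)] encodes_padding[OF C ic that] encodes_padding[OF D ic that] by simp
qed

lemma encodes_smult:
  assumes C: "encodes k f C"
  shows "encodes k (\<lambda>s. to_ac x * f s) (x \<odot>\<^bsub>V\<^esub> C)"
proof (rule encodesI)
  show "x \<odot>\<^bsub>V\<^esub> C \<in> carrier V"
    using encodes_carrier[OF C] by (simp add: mat_tuples_simps)
  fix i c
  assume ic: "i \<in> {1..t}" "c < n i"
  have at: "(x \<odot>\<^bsub>V\<^esub> C) i $$ (r, c) = x * C i $$ (r, c)" if "r < m i" for r
    using ic that encodes_carrier[OF C ic(1)] by (simp add: mat_tuples_simps)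
  have "comb i (\<lambda>r. (x \<odot>\<^bsub>V\<^esub> C) i $$ (r, c)) = comb i (\<lambda>r. x * C i $$ (r, c))"
    using M_le_m[OF ic(1)] by (intro comb_cong at) simp
  then show "comb i (\<lambda>r. (x \<odot>\<^bsub>V\<^esub> C) i $$ (r, c)) = lin_eval k (\<lambda>s. to_ac x * f s) (b i c)"
    using encodes_comb[OF C ic]
    by (simp add: comb_scale lin_eval_def algebra_simps sum_distrib_left)
  show "(x \<odot>\<^bsub>V\<^esub> C) i $$ (r, c) = 0" if "M \<le> r" "r < m i" for r
    using at[OF that(2)] encodes_padding[OF C ic that] by simp
qed

section \<open>Linearity and nesting of the codes\<close>

lemma is_code_code: "is_code t m n (code k)"
  unfolding is_code_def
proof (rule VectorSpace.subspace.intro)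
  show "vectorspace class_ring V"
    by (rule vectorspace_mat_tuples)
  show "LinearCombinations.submodule class_ring (code k) V"
  proof (rule LinearCombinations.submodule.intro)
    show "Module.module class_ring V"
      using vectorspace_mat_tuples[where 'a = 'a] unfolding vectorspace_def by blast
    show "code k \<subseteq> carrier V"
      by (auto simp: code_def encodes_def)
    show "\<zero>\<^bsub>V\<^esub> \<in> code k"
      unfolding code_def using encodes_zero[of k "\<lambda>_. 0"] zero_in_frob_eigenspace by blast
    fix C D
    assume "C \<in> code k" "D \<in> code k"
    then obtain f g where f: "f \<in> {..<k} \<rightarrow> frob_eigenspace M 1" "encodes k f C"
      and g: "g \<in> {..<k} \<rightarrow> frob_eigenspace M 1" "encodes k g D"
      by (auto simp: code_def)
    have "(\<lambda>s. f s + g s) \<in> {..<k} \<rightarrow> frob_eigenspace M 1"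
      using f(1) g(1) by (simp add: Pi_iff frob_eigenspace_add)
    then show "C \<oplus>\<^bsub>V\<^esub> D \<in> code k"
      unfolding code_def using encodes_add[OF f(2) g(2)] by blast
  next
    fix x C
    assume "C \<in> code k"
    then obtain f where f: "f \<in> {..<k} \<rightarrow> frob_eigenspace M 1" "encodes k f C"
      by (auto simp: code_def)
    have "(\<lambda>s. to_ac x * f s) \<in> {..<k} \<rightarrow> frob_eigenspace M 1"
      using f(1) by (simp add: Pi_iff frob_eigenspace_scale)
    then show "x \<odot>\<^bsub>V\<^esub> C \<in> code k"
      unfolding code_def using encodes_smult[OF f(2)] by blast
  qed
qed

text \<open>A new top coefficient 0 does not change the polynomial. This gives the chain of
  inclusions.\<close>

lemma code_mono: "code k \<subseteq> code (Suc k)"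
proof
  fix C
  assume "C \<in> code k"
  then obtain f where f: "f \<in> {..<k} \<rightarrow> frob_eigenspace M 1" "encodes k f C"
    by (auto simp: code_def)
  have "lin_eval (Suc k) (f(k := 0)) x = lin_eval k f x" for x
    by (simp add: lin_eval_def)
  then have "encodes (Suc k) (f(k := 0)) C"
    using f(2) by (simp add: encodes_def)
  moreover have "f(k := 0) \<in> {..<Suc k} \<rightarrow> frob_eigenspace M 1"
    using f(1) zero_in_frob_eigenspace[of M 1] by (auto simp: Pi_iff less_Suc_eq)
  ultimately show "C \<in> code (Suc k)"
    by (auto simp: code_def)
qed

section \<open>Kernels of the blocks and bounds on the sum-rank weight\<close>

definition point :: "nat \<Rightarrow> 'a vec \<Rightarrow> 'a alg_closure" where
  "point i v = (\<Sum>c<n i. to_ac (v $ c) * b i c)"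

lemma point_eq_comb:
  assumes "i \<in> {1..t}"
  shows "point i v = comb i (\<lambda>r. if r < n i then v $ r else 0)"
  unfolding point_def comb_def
  using n_le_M[OF assms] by (intro sum.mono_neutral_cong_left) auto

lemma point_inj:
  assumes i: "i \<in> {1..t}" and v: "v \<in> carrier_vec (n i)" and w: "w \<in> carrier_vec (n i)"
    and eq: "point i v = point i w"
  shows "v = w"
proof (rule eq_vecI)
  fix c
  assume "c < dim_vec w"
  then have c: "c < n i" "c < M"
    using w n_le_M[OF i] by auto
  then show "v $ c = w $ c"
    using comb_eqD[OF i eq[unfolded point_eq_comb[OF i]] c(2)] by simp
qed (use v w in auto)

text \<open>By linearity over the ground field, the first \<open>M\<close> entries of
  \<open>C i *\<^sub>v v\<close> are the coordinates of the polynomial's value at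
  \<open>point i v\<close>; the padding makes the remaining entries zero.\<close>

lemma encodes_mult_vec_eq_0_iff:
  assumes C: "encodes k f C" and i: "i \<in> {1..t}" and v: "v \<in> carrier_vec (n i)"
  shows "C i *\<^sub>v v = 0\<^sub>v (m i) \<longleftrightarrow> lin_eval k f (point i v) = 0"
proof -
  have Ci: "C i \<in> carrier_mat (m i) (n i)"
    by (rule encodes_carrier[OF C i])
  let ?e = "\<lambda>r. \<Sum>c<n i. C i $$ (r, c) * v $ c"
  have e: "(C i *\<^sub>v v) $ r = ?e r" if "r < m i" for r
    using Ci v that by (simp add: scalar_prod_def atLeast0LessThan)
  have "lin_eval k f (point i v) = (\<Sum>c<n i. to_ac (v $ c) * comb i (\<lambda>r. C i $$ (r, c)))"
    by (simp add: point_def lin_eval_sum lin_eval_scale encodes_comb[OF C i])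
  also have "\<dots> = comb i ?e"
    unfolding comb_def
    by (simp add: sum_distrib_left sum_distrib_right to_ac_sum sum.swap[of _ "{..<M}"] mult_ac)
  finally have comb: "lin_eval k f (point i v) = comb i ?e" .
  show ?thesis
  proof
    assume 0: "C i *\<^sub>v v = 0\<^sub>v (m i)"
    have "?e r = 0" if "r < M" for r
      using that M_le_m[OF i] e[of r] 0 by simp
    then have "comb i ?e = comb i (\<lambda>r. 0)"
      by (intro comb_cong) simp
    then show "lin_eval k f (point i v) = 0"
      by (simp add: comb comb_0)
  next
    assume "lin_eval k f (point i v) = 0"
    then have eq: "comb i ?e = comb i (\<lambda>r. 0)"
      by (simp add: comb comb_0)
    have "?e r = 0" if "r < m i" for r
    proof (cases "r < M")
      case True
      then show ?thesis
        using comb_eqD[OF i eq True] by simp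
    next
      case False
      then show ?thesis
        using encodes_padding[OF C i _ _ that] by simp
    qed
    then show "C i *\<^sub>v v = 0\<^sub>v (m i)"
      using Ci e by (intro eq_vecI) auto
  qed
qed

text \<open>The kernels of the blocks inject into the root set of the linearized polynomial, since
  the eigenspaces are linearly independent.\<close>

lemma srk_lower_bound:
  assumes C: "encodes k f C" and s: "s < k" "f s \<noteq> 0"
  shows "(\<Sum>i\<in>{1..t}. n i) < srk t m C + k"
proof -
  let ?q = "CARD('a)"
  let ?ker = "\<lambda>i. {v \<in> carrier_vec (n i). C i *\<^sub>v v = 0\<^sub>v (m i)}"
  let ?K = "\<Pi>\<^sub>E i\<in>{1..t}. ?ker i"
  let ?roots = "{x. lin_eval k f x = 0}"
  let ?g = "\<lambda>w. \<Sum>i\<in>{1..t}. point i (w i)"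
  have "inj_on ?g ?K"
  proof (rule inj_onI)
    fix v w
    assume v: "v \<in> ?K" and w: "w \<in> ?K" and eq: "?g v = ?g w"
    let ?x = "\<lambda>i. point i (v i) - point i (w i)"
    have "\<forall>i\<in>{1..t}. ?x i = 0"
    proof (rule sum_pairwise_distinct_eigenvectors_eq_0[OF _ inj_a, where m = M])
      fix i
      assume i: "i \<in> {1..t}"
      then have "?x i \<in> frob_eigenspace M (a i)"
        by (intro frob_eigenspace_diff) (simp_all only: point_eq_comb comb_in)
      then show "?x i ^ (?q ^ M) = to_ac (a i) * ?x i"
        by (simp add: frob_eigenspace_def)
    qed (use eq in \<open>simp_all add: sum_subtractf\<close>)
    then show "v = w"
      using v w by (intro PiE_ext[OF v w] point_inj) (auto simp: PiE_iff)
  qed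
  moreover have "?g ` ?K \<subseteq> ?roots"
  proof (rule image_subsetI)
    fix w
    assume "w \<in> ?K"
    then have "lin_eval k f (point i (w i)) = 0" if "i \<in> {1..t}" for i
      using encodes_mult_vec_eq_0_iff[OF C that, of "w i"] that by (auto simp: PiE_iff)
    then show "?g w \<in> ?roots"
      by (simp add: lin_eval_sum)
  qed
  ultimately have "card ?K \<le> ?q ^ (k - 1)"
    using card_inj_on_le lin_eval_roots[of s k f, OF s] order_trans by blast
  \<comment> \<open>Rank-nullity in each block makes the left side a power of \<open>?q\<close> with
    the total number of columns as exponent, so exponents can be compared.\<close>
  then have "?q ^ srk t m C * card ?K \<le> ?q ^ (srk t m C + (k - 1))"
    by (simp add: power_add)
  moreover have "?q ^ srk t m C * card ?K = (\<Prod>i\<in>{1..t}. ?q ^ vec_space.rank (m i) (C i) * card (?ker i))"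
    by (simp add: srk_def power_sum card_PiE prod.distrib)
  moreover have "\<dots> = (\<Prod>i\<in>{1..t}. ?q ^ n i)"
    using card_mat_kernel[OF encodes_carrier[OF C]] by (intro prod.cong) auto
  moreover have "\<dots> = ?q ^ (\<Sum>i\<in>{1..t}. n i)"
    by (simp add: power_sum)
  ultimately have "?q ^ (\<Sum>i\<in>{1..t}. n i) \<le> ?q ^ (srk t m C + (k - 1))"
    by simp
  then have "(\<Sum>i\<in>{1..t}. n i) \<le> srk t m C + (k - 1)"
    by (rule power_le_imp_le_exp[OF card_finite_field_gt_1])
  then show ?thesis
    using s(1) by simp
qed

text \<open>A dimension count yields a nonzero polynomial vanishing at \<open>k - 1\<close> prescribed basis vectors,
  that is, a codeword with \<open>k - 1\<close> zero columns.\<close>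

lemma ex_srk_upper_bound:
  assumes k: "1 \<le> k" "k \<le> (\<Sum>i\<in>{1..t}. n i)"
  shows "\<exists>f\<in>{..<k} \<rightarrow> frob_eigenspace M 1. \<exists>C. (\<exists>s<k. f s \<noteq> 0) \<and> encodes k f C
    \<and> srk t m C + k \<le> (\<Sum>i\<in>{1..t}. n i) + 1"
proof -
  let ?q = "CARD('a)"
  let ?P = "SIGMA i:{1..t}. {..<n i}"
  let ?L = "frob_eigenspace M 1 :: 'a alg_closure set"
  have card_P: "card ?P = (\<Sum>i\<in>{1..t}. n i)"
    by simp
  then have "k - 1 \<le> card ?P"
    using k(2) by linarith
  \<comment> \<open>\<open>S\<close> selects the \<open>k - 1\<close> columns that are to
    vanish.\<close>
  then obtain S where S: "S \<subseteq> ?P" "card S = k - 1"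
    by (rule obtain_subset_with_card_n) blast
  then have fin_S: "finite S"
    using finite_subset[of S ?P] by auto
  have card_L: "card (frob_eigenspace M (1 :: 'a)) = ?q ^ M"
    using M_pos by (simp add: card_frob_eigenspace)
  have card_E: "card (frob_eigenspace M (a i)) = ?q ^ M" if "i \<in> {1..t}" for i
    using bij_betw_same_card[OF b_basis[OF that]] by (simp add: card_PiE)
  have fin_E: "finite (frob_eigenspace M (a i))" if "i \<in> {1..t}" for i
    using card_E[OF that] by (intro card_ge_0_finite) simp
  let ?H = "\<lambda>f. \<lambda>p\<in>S. lin_eval k f (b (fst p) (snd p))"
  let ?A = "{..<k} \<rightarrow>\<^sub>E ?L"
  let ?B = "\<Pi>\<^sub>E p\<in>S. frob_eigenspace M (a (fst p))"
  have S_D: "fst p \<in> {1..t}" "snd p < n (fst p)" "snd p < M" if "p \<in> S" for p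
  proof -
    show p: "fst p \<in> {1..t}" "snd p < n (fst p)"
      using that S(1) by (cases p; auto)+
    then show "snd p < M"
      using n_le_M[of "fst p"] by linarith
  qed
  have sub: "?H ` ?A \<subseteq> ?B"
  proof (intro image_subsetI restrict_PiE_iff[THEN iffD2] ballI)
    fix f p
    assume "f \<in> ?A" "p \<in> S"
    then show "lin_eval k f (b (fst p) (snd p)) \<in> frob_eigenspace M (a (fst p))"
      using S_D by (intro lin_eval_in_frob_eigenspace b_in) auto
  qed
  have fin_B: "finite ?B"
    using fin_S S_D fin_E by (intro finite_PiE) auto
  have card_B: "card ?B = (?q ^ M) ^ (k - 1)"
    using fin_S S_D(1) card_E S(2) by (simp add: card_PiE)
  \<comment> \<open>There are \<open>(?q ^ M) ^ k\<close> polynomials but at most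
    \<open>(?q ^ M) ^ (k - 1)\<close> tuples of values on \<open>S\<close>. Two polynomials
    therefore agree on \<open>S\<close>, and their difference \<open>?h\<close> vanishes
    there.\<close>
  have "card (?H ` ?A) \<le> (?q ^ M) ^ (k - 1)"
    using card_mono[OF fin_B sub] unfolding card_B .
  also have "\<dots> < (?q ^ M) ^ k"
    using k(1) M_pos card_finite_field_gt_1[where 'a = 'a]
    by (intro power_strict_increasing one_less_power) auto
  also have "\<dots> = card ?A"
    by (simp add: card_PiE card_L)
  finally have "\<not> inj_on ?H ?A"
    by (rule pigeonhole)
  then obtain f g where fg: "f \<in> ?A" "g \<in> ?A" "f \<noteq> g" "?H f = ?H g"
    unfolding inj_on_def by blast
  let ?h = "\<lambda>s. f s - g s"
  have h: "?h \<in> {..<k} \<rightarrow> ?L"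
    using fg(1,2) by (auto intro: frob_eigenspace_diff)
  have "\<exists>s<k. f s \<noteq> g s"
    using PiE_ext[OF fg(1,2)] fg(3) by auto
  then have nz: "\<exists>s<k. ?h s \<noteq> 0"
    by simp
  obtain C where C: "encodes k ?h C"
    using ex_encodes[OF h] by blast
  \<comment> \<open>Columns indexed by \<open>S\<close> are zero, so only the other columns of block
    \<open>i\<close> count towards its rank.\<close>
  have rank: "vec_space.rank (m i) (C i) \<le> card {c \<in> {..<n i}. (i, c) \<notin> S}" if i: "i \<in> {1..t}" for i
  proof -
    have Ci: "C i \<in> carrier_mat (m i) (n i)"
      by (rule encodes_carrier[OF C i])
    have "col (C i) c = 0\<^sub>v (m i)" if "(i, c) \<in> S" for c
    proof -
      have c: "c < n i"
        using S_D(2)[OF that] by simp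
      have "lin_eval k ?h (b i c) = 0"
        using fun_cong[OF fg(4), of "(i, c)"] that by (simp add: lin_eval_diff_coeffs)
      then have eq: "comb i (\<lambda>r. C i $$ (r, c)) = comb i (\<lambda>r. 0)"
        using encodes_comb[OF C i c] by (simp add: comb_0)
      have "C i $$ (r, c) = 0" if "r < m i" for r
        using comb_eqD[OF i eq, of r] encodes_padding[OF C i c _ that] by (cases "r < M") auto
      then show ?thesis
        using Ci c by (intro eq_vecI) auto
    qed
    then have "{c \<in> {..<n i}. col (C i) c \<noteq> 0\<^sub>v (m i)} \<subseteq> {c \<in> {..<n i}. (i, c) \<notin> S}"
      by auto
    then show ?thesis
      using rank_le_card_nonzero_cols[OF Ci] card_mono order_trans
      by (metis (no_types, lifting) finite_Collect_conjI finite_lessThan lessThan_iff finite_subset mem_Collect_eq subsetI)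
  qed
  have "srk t m C \<le> (\<Sum>i\<in>{1..t}. card {c \<in> {..<n i}. (i, c) \<notin> S})"
    unfolding srk_def by (rule sum_mono) (rule rank)
  also have "\<dots> = card (SIGMA i:{1..t}. {c \<in> {..<n i}. (i, c) \<notin> S})"
    by simp
  also have "(SIGMA i:{1..t}. {c \<in> {..<n i}. (i, c) \<notin> S}) = ?P - S"
    by auto
  also have "card (?P - S) = (\<Sum>i\<in>{1..t}. n i) - (k - 1)"
    using S fin_S card_P by (simp add: card_Diff_subset)
  finally have "srk t m C + k \<le> (\<Sum>i\<in>{1..t}. n i) + 1"
    using k by simp
  then show ?thesis
    using h nz C by (intro bexI[of _ ?h] exI[of _ C]) auto
qed

section \<open>Size, dimension and minimum distance of the codes\<close>

lemma card_code:
  assumes "k \<le> (\<Sum>i\<in>{1..t}. n i)"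
  shows "finite (code k)" and "card (code k) = CARD('a) ^ (M * k)"
proof -
  let ?L = "frob_eigenspace M 1 :: 'a alg_closure set"
  let ?A = "{..<k} \<rightarrow>\<^sub>E ?L"
  let ?enc = "\<lambda>f. SOME C. encodes k f C"
  have enc: "encodes k f (?enc f)" if "f \<in> ?A" for f
  proof -
    have "f \<in> {..<k} \<rightarrow> ?L"
      using that by (simp add: PiE_iff)
    then show ?thesis
      by (rule someI_ex[OF ex_encodes])
  qed
  have card_L: "card ?L = CARD('a) ^ M"
    using M_pos by (simp add: card_frob_eigenspace)
  have bij: "bij_betw ?enc ?A (code k)"
  proof (rule bij_betw_imageI)
    show "inj_on ?enc ?A"
    proof (rule inj_onI)
      fix f g
      assume f: "f \<in> ?A" and g: "g \<in> ?A" and eq: "?enc f = ?enc g"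
      let ?h = "\<lambda>s. f s - g s"
      have h: "encodes k ?h \<zero>\<^bsub>V\<^esub>"
        using encodes_same_diff[of k f "?enc g" g] enc[OF f] enc[OF g] eq by simp
      have "srk t m (\<zero>\<^bsub>V\<^esub>) = 0"
        by (simp add: srk_def mat_tuples_simps vec_space.rank_0I)
      \<comment> \<open>The zero tuple has weight 0, so a nonzero coefficient would force
        \<open>k\<close> above the total number of columns.\<close>
      then have "?h s = 0" if "s < k" for s
        using srk_lower_bound[OF h that] assms by fastforce
      then show "f = g"
        using PiE_ext[OF f g] by simp
    qed
    show "?enc ` ?A = code k"
    proof (intro equalityI subsetI)
      fix C
      assume "C \<in> code k"
      then obtain f where f: "f \<in> {..<k} \<rightarrow> ?L" "encodes k f C"
        by (auto simp: code_def)
      \<comment> \<open>Making the coefficients extensional keeps the evaluation and yields an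
        element of \<open>?A\<close>.\<close>
      let ?f = "restrict f {..<k}"
      have "lin_eval k ?f x = lin_eval k f x" for x
        by (simp add: lin_eval_def)
      then have "encodes k ?f C"
        using f(2) by (simp add: encodes_def)
      moreover have "?f \<in> ?A"
        using f(1) by auto
      ultimately show "C \<in> ?enc ` ?A"
        using encodes_unique enc by (metis (no_types, lifting) image_eqI)
    qed (use enc in \<open>auto simp: code_def\<close>)
  qed
  have "finite ?L"
    using card_L by (intro card_ge_0_finite) simp
  then show "finite (code k)"
    using bij_betw_finite[OF bij] by (simp add: finite_PiE)
  show "card (code k) = CARD('a) ^ (M * k)"
    using bij_betw_same_card[OF bij] by (simp add: card_PiE card_L power_mult)
qed

lemma code_dim_code:
  assumes "k \<le> (\<Sum>i\<in>{1..t}. n i)"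
  shows "code_dim t m n (code k) = M * k"
proof -
  interpret vectorspace class_ring V
    by (rule vectorspace_mat_tuples)
  have "vectorspace class_ring (V\<lparr>carrier := code k\<rparr>)"
    using is_code_code subspace_is_vs by (simp add: is_code_def)
  from card_vectorspace[OF this] have "CARD('a) ^ (M * k) = CARD('a) ^ code_dim t m n (code k)"
    using card_code[OF assms] by (simp add: code_dim_def)
  then show ?thesis
    using card_finite_field_gt_1[where 'a = 'a] by simp
qed

lemma code_nontrivial:
  assumes "1 \<le> k" "k \<le> (\<Sum>i\<in>{1..t}. n i)"
  shows "code k \<noteq> {\<zero>\<^bsub>V\<^esub>}"
proof
  assume "code k = {\<zero>\<^bsub>V\<^esub>}"
  then have "CARD('a) ^ (M * k) = 1"
    using card_code(2)[OF assms(2)] by simp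
  then show False
    using assms(1) M_pos card_finite_field_gt_1[where 'a = 'a] by simp
qed

lemma min_dist_code:
  assumes k: "1 \<le> k" "k \<le> (\<Sum>i\<in>{1..t}. n i)"
  shows "min_dist t m n (code k) = (\<Sum>i\<in>{1..t}. n i) + 1 - k"
  unfolding min_dist_def
proof (rule Min_eqI)
  let ?N = "\<Sum>i\<in>{1..t}. n i"
  show "finite (srk t m ` (code k - {\<zero>\<^bsub>V\<^esub>}))"
    using card_code(1)[OF k(2)] by simp
  show "?N + 1 - k \<le> w" if "w \<in> srk t m ` (code k - {\<zero>\<^bsub>V\<^esub>})" for w
  proof -
    from that obtain f C where C: "encodes k f C" "C \<noteq> \<zero>\<^bsub>V\<^esub>" "w = srk t m C"
      by (auto simp: code_def)
    \<comment> \<open>The zero polynomial encodes only the zero tuple, so a nonzero codeword has a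
      nonzero coefficient.\<close>
    then obtain s where "s < k" "f s \<noteq> 0"
      using encodes_unique[OF C(1) encodes_zero] by blast
    from srk_lower_bound[OF C(1) this] C(3) show ?thesis
      by simp
  qed
  obtain f C s where f: "f \<in> {..<k} \<rightarrow> frob_eigenspace M 1" and s: "s < k" "f s \<noteq> 0"
    and C: "encodes k f C" and upper: "srk t m C + k \<le> ?N + 1"
    using ex_srk_upper_bound[OF k] by blast
  have lower: "?N < srk t m C + k"
    by (rule srk_lower_bound[OF C s])
  have "srk t m (\<zero>\<^bsub>V\<^esub>) = 0"
    by (simp add: srk_def mat_tuples_simps vec_space.rank_0I)
  \<comment> \<open>Weight 0 would contradict \<open>lower\<close>, since \<open>k\<close> is at
    most \<open>?N\<close>.\<close>
  then have "C \<noteq> \<zero>\<^bsub>V\<^esub>"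
    using lower k(2) by auto
  moreover have "C \<in> code k"
    using f C by (auto simp: code_def)
  moreover have "?N + 1 - k = srk t m C"
    using lower upper by simp
  ultimately show "?N + 1 - k \<in> srk t m ` (code k - {\<zero>\<^bsub>V\<^esub>})"
    by blast
qed

end

section \<open>Locating a distance among the blocks and matching the MSRD parameters\<close>

lemma ex_block_decomposition:
  fixes n :: "nat \<Rightarrow> nat"
  assumes "0 < i" and "i \<le> (\<Sum>k\<in>{1..t}. n k)"
  shows "\<exists>l\<in>{1..t}. \<exists>\<delta><n l. i = (\<Sum>k\<in>{1..<l}. n k) + \<delta> + 1"
  using assms(2)
proof (induction t)
  case (Suc t)
  show ?case
  \<comment> \<open>Position \<open>i\<close>, counted from 1, falls into block \<open>l\<close> at
    offset \<open>\<delta>\<close>, counted from 0: either within the earlier blocks or in the new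
    last one.\<close>
  proof (cases "i \<le> (\<Sum>k\<in>{1..t}. n k)")
    case True
    then obtain l \<delta> where "l \<in> {1..t}" "\<delta> < n l" "i = (\<Sum>k\<in>{1..<l}. n k) + \<delta> + 1"
      using Suc.IH by blast
    then show ?thesis
      by (intro bexI[of _ l] exI[of _ \<delta>]) auto
  next
    case False
    let ?\<delta> = "i - (\<Sum>k\<in>{1..t}. n k) - 1"
    have "?\<delta> < n (Suc t)" "i = (\<Sum>k\<in>{1..<Suc t}. n k) + ?\<delta> + 1"
      using False Suc.prems by (simp_all add: atLeastLessThanSuc_atLeastAtMost)
    then show ?thesis
      by (intro bexI[of _ "Suc t"] exI[of _ ?\<delta>]) auto
  qed
qed (use assms(1) in simp)

context linearized_reed_solomon
begin

text \<open>The number of coefficients is the one for which \<open>min_dist_code\<close> yields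
  \<open>i\<close>. As \<open>i\<close> lies beyond the blocks before \<open>j\<close>, only blocks
  with \<open>m p = M\<close> enter the required dimension, which becomes \<open>M\<close> times
  that number.\<close>

lemma MSRD_code:
  assumes i: "(\<Sum>k\<in>{1..<j}. n k) < i" "i \<le> (\<Sum>k\<in>{1..t}. n k)"
    and m_eq: "\<And>p. p \<in> {j..t} \<Longrightarrow> m p = M"
  shows "MSRD t m n (code ((\<Sum>k\<in>{1..t}. n k) + 1 - i))"
    and "min_dist t m n (code ((\<Sum>k\<in>{1..t}. n k) + 1 - i)) = i"
proof -
  let ?N = "\<Sum>k\<in>{1..t}. n k"
  let ?k = "?N + 1 - i"
  have k: "1 \<le> ?k" "?k \<le> ?N"
    using i by auto
  show dist: "min_dist t m n (code ?k) = i"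
    using min_dist_code[OF k] i by simp
  obtain l \<delta> where l: "l \<in> {1..t}" and \<delta>: "\<delta> < n l" and i_eq: "i = (\<Sum>k\<in>{1..<l}. n k) + \<delta> + 1"
    using ex_block_decomposition[of i n t] i by auto
  \<comment> \<open>Otherwise block \<open>l\<close>, and with it position \<open>i\<close>, would
    lie entirely before block \<open>j\<close>.\<close>
  have "j \<le> l"
  proof (rule ccontr)
    assume "\<not> j \<le> l"
    then have "(\<Sum>k\<in>{1..<Suc l}. n k) \<le> (\<Sum>k\<in>{1..<j}. n k)"
      by (intro sum_mono2) auto
    moreover have "(\<Sum>k\<in>{1..<Suc l}. n k) = (\<Sum>k\<in>{1..<l}. n k) + n l"
      using l by simp
    ultimately show False
      using i(1) i_eq \<delta> by linarith
  qed
  have "?N = (\<Sum>k\<in>{1..<l}. n k) + (\<Sum>k\<in>{l..t}. n k)"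
    using l by (subst sum.union_disjoint[symmetric]) (auto intro!: sum.cong)
  \<comment> \<open>The two off-by-one terms, in \<open>?k\<close> and in \<open>i_eq\<close>,
    cancel.\<close>
  then have k_eq: "?k = (\<Sum>k\<in>{l..t}. n k) - \<delta>"
    using i_eq by linarith
  have "(\<Sum>p\<in>{l..t}. m p * n p) = M * (\<Sum>p\<in>{l..t}. n p)"
    using m_eq \<open>j \<le> l\<close> by (simp add: sum_distrib_left)
  moreover have "m l = M"
    using m_eq \<open>j \<le> l\<close> l by simp
  ultimately have "code_dim t m n (code ?k) = (\<Sum>p\<in>{l..t}. m p * n p) - \<delta> * m l"
    unfolding code_dim_code[OF k(2)] unfolding k_eq by (simp add: diff_mult_distrib2 mult.commute)
  moreover have "\<delta> \<le> n l - 1"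
    using \<delta> by simp
  ultimately show "MSRD t m n (code ?k)"
    unfolding MSRD_def using is_code_code code_nontrivial[OF k] dist i_eq l by blast
qed

end

section \<open>The chain of codes for all distances from \<open>d\<close> on\<close>

theorem proposition4p16:
  fixes t j d :: nat and n m :: "nat \<Rightarrow> nat"
  assumes t_pos: "t \<ge> 1"
    and n_pos: "\<And>i. i \<in> {1..t} \<Longrightarrow> n i \<ge> 1"
    and m_pos: "\<And>i. i \<in> {1..t} \<Longrightarrow> m i \<ge> 1"
    and m_decreasing: "\<And>i k. 1 \<le> i \<Longrightarrow> i \<le> k \<Longrightarrow> k \<le> t \<Longrightarrow> m k \<le> m i"
    and n_le_m: "\<And>i. i \<in> {1..t} \<Longrightarrow> n i \<le> m i"
    and j_eq: "j = Min {i \<in> {1..t}. m i = m t}"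
    and d_eq: "d = (\<Sum>i\<in>{1..<j}. n i) + 1"
    and n_le_mt: "\<And>i. i \<in> {1..t} \<Longrightarrow> n i \<le> m t"
    and q_gt_t: "CARD('a::{field,finite}) > t"
  shows "\<exists>\<C> :: nat \<Rightarrow> (nat \<Rightarrow> 'a mat) set.
    (\<forall>i. d \<le> i \<and> i \<le> (\<Sum>k\<in>{1..t}. n k) \<longrightarrow> MSRD t m n (\<C> i) \<and> min_dist t m n (\<C> i) = i) \<and>
    (\<forall>i. d \<le> i \<and> i < (\<Sum>k\<in>{1..t}. n k) \<longrightarrow> \<C> (i + 1) \<subseteq> \<C> i)"
proof -
  let ?N = "\<Sum>k\<in>{1..t}. n k"
  have M_pos: "0 < m t"
    using m_pos[of t] t_pos by simp
  \<comment> \<open>The field has \<open>CARD('a) - 1 \<ge> t\<close> nonzero elements, enough for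
    one eigenvalue per block.\<close>
  have "card {1..t} \<le> card (UNIV - {0 :: 'a})"
    using q_gt_t by (simp add: card_Diff_singleton)
  then obtain a :: "nat \<Rightarrow> 'a" where a: "a ` {1..t} \<subseteq> UNIV - {0}" "inj_on a {1..t}"
    using card_le_inj[of "{1..t}" "UNIV - {0 :: 'a}"] by auto
  let ?basis = "\<lambda>i b. (\<forall>r<m t. b r \<in> frob_eigenspace (m t) (a i)) \<and>
    bij_betw (\<lambda>v. \<Sum>r<m t. to_ac (v r) * b r) ({..<m t} \<rightarrow>\<^sub>E UNIV) (frob_eigenspace (m t) (a i))"
  have "\<forall>i\<in>{1..t}. \<exists>b. ?basis i b"
  proof
    fix i
    assume "i \<in> {1..t}"
    then have "a i \<noteq> 0"
      using a(1) by blast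
    then show "\<exists>b. ?basis i b"
      by (rule ex_frob_eigenspace_basis[OF M_pos])
  qed
  from bchoice[OF this] obtain b where b: "\<forall>i\<in>{1..t}. ?basis i (b i)"
    by blast
  interpret linearized_reed_solomon t "m t" n m a b
    using M_pos n_le_mt m_decreasing a(2) b by unfold_locales auto
  have "j \<in> {i \<in> {1..t}. m i = m t}"
    unfolding j_eq using t_pos by (intro Min_in) auto
  \<comment> \<open>\<open>m\<close> is decreasing and takes equal values at \<open>j\<close> and
    \<open>t\<close>, so it is constant in between.\<close>
  then have m_eq: "m p = m t" if "p \<in> {j..t}" for p
    using that m_decreasing[of p t] m_decreasing[of j p] by auto
  \<comment> \<open>A larger distance means fewer coefficients, so \<open>code_mono\<close> gives
    inclusions in the required direction.\<close>
  let ?\<C> = "\<lambda>i. code (?N + 1 - i)"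
  have "MSRD t m n (?\<C> i) \<and> min_dist t m n (?\<C> i) = i" if "d \<le> i" "i \<le> ?N" for i
  proof -
    have "(\<Sum>k\<in>{1..<j}. n k) < i"
      using that(1) d_eq by simp
    then show ?thesis
      using MSRD_code[OF _ that(2) m_eq] by blast
  qed
  moreover have "?\<C> (i + 1) \<subseteq> ?\<C> i" if "i < ?N" for i
    using code_mono[of "?N - i"] that by (simp add: Suc_diff_le)
  ultimately show ?thesis
    by (intro exI[of _ ?\<C>]) blast
qed

end
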